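(* Suppose that $\mathscr{B}\subset\mathbb{N}$ is primitive, has light tails and contains an infinite pairwise coprime subset. Denote by $(n_j)_{j\ge1}$ the increasing sequence of consecutive natural $\mathscr{B}$-free numbers. Then $$\limsup_{j\to\infty}\inf_{0\leq k\leq K}(n_{j+k+1}-n_{j+k})=\infty\quad\text{for any }K\geq 1.$$
   Context: $\mathbb{N}=\{1,2,\dots\}$. The $\mathscr{B}$-free numbers are the elements of $\mathcal{F}_{\mathscr{B}}:=\mathbb{Z}\setminus\bigcup_{b\in\mathscr{B}}b\mathbb{Z}$; $(n_j)$ enumerates $\mathcal{F}_{\mathscr{B}}\cap\mathbb{N}$ in increasing order. $\mathscr{B}$ is primitive if no element of $\mathscr{B}$ divides another element of $\mathscr{B}$. The upper density of $A\subset\mathbb{Z}$ is $\overline{d}(A)=\limsup_{N\to\infty}\frac1N|A\cap[1,N]|$. $\mathscr{B}$ has light tails if $\lim_{K\to\infty}\overline{d}\left(\bigcup_{b\in\mathscr{B},\,b>K}b\mathbb{Z}\right)=0$. *)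

theory Defs
  imports Complex_Main "HOL-Library.Infinite_Set" "HOL-Library.Extended_Real"
begin

definition multiples_of_set :: "nat set \<Rightarrow> int set" where
  "multiples_of_set B = (\<Union>b\<in>B. {m. int b dvd m})"

definition free_integers :: "nat set \<Rightarrow> int set" where
  "free_integers B = UNIV - multiples_of_set B"

definition natural_free_numbers :: "nat set \<Rightarrow> nat set" where
  "natural_free_numbers B = {n. 1 \<le> n \<and> int n \<in> free_integers B}"

(* Indexed from 0: free_number_seq B j is the (j+1)-st natural free number.
   The library's enumeration is the increasing one only when the set is
   infinite; on a finite set it is unspecified beyond the last element. *)
definition free_number_seq :: "nat set \<Rightarrow> nat \<Rightarrow> nat" where
  "free_number_seq B = enumerate (natural_free_numbers B)"

definition primitive_set :: "nat set \<Rightarrow> bool" where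
  "primitive_set B \<longleftrightarrow> (\<forall>a\<in>B. \<forall>b\<in>B. a \<noteq> b \<longrightarrow> \<not> a dvd b)"

definition upper_density :: "int set \<Rightarrow> ereal" where
  "upper_density A = limsup (\<lambda>N::nat. ereal (real (card (A \<inter> {1..int N})) / real N))"

definition light_tails :: "nat set \<Rightarrow> bool" where
  "light_tails B \<longleftrightarrow>
     (\<lambda>K::nat. upper_density (multiples_of_set {b \<in> B. b > K})) \<longlonglongrightarrow> 0"

end

theory Submission
  imports Defs "HOL-Analysis.Extended_Real_Limits" "HOL-Number_Theory.Cong"
begin

text \<open>
  The idea is to find an arithmetic progression \<open>x, x + L, \<dots>, x + (K + 1) * L\<close> of free numbers with
  an arbitrarily large difference \<open>L\<close> and no other free number in between. Such a
  progression yields \<open>K + 1\<close> consecutive gaps equal to \<open>L\<close>, and infinitely many such \<open>x\<close> give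
  the limit superior.

  To clear the gaps, give each position \<open>s\<close> between the points of the progression its own element
  \<open>c s\<close> of the infinite pairwise coprime subset, and impose \<open>x \<equiv> - s\<close> modulo \<open>c s\<close>. To
  keep the points of the progression free, let \<open>L\<close> be a multiple of all elements of \<open>B\<close> up to a bound
  \<open>T\<close>, impose \<open>x \<equiv> 1\<close> modulo \<open>L\<close>, and take each \<open>c s\<close> without prime factors
  up to the length of the window. By the Chinese remainder theorem these conditions define a residue class
  modulo some \<open>q\<close>, and they make every \<open>x + i * L\<close> coprime to \<open>q\<close>
  (\<open>ex_residue_sieving_all_but_progression\<close>). Hence only elements of \<open>B\<close> coprime to
  \<open>q\<close>, all of them larger than \<open>T\<close>, can still divide some \<open>x + i * L\<close>.

  The difficulty is that \<open>q\<close> is chosen after \<open>T\<close>, so the density \<open>1 / q\<close> of the class may be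
  far below the density of the multiples of elements larger than \<open>T\<close>. What saves the argument is
  independence: for a set \<open>D\<close> of moduli coprime to \<open>q\<close>, the multiples of \<open>D\<close> occupy a
  residue class modulo \<open>q\<close> with upper density at most \<open>1 / q\<close> times their own. This is exact for finite
  \<open>D\<close> by periodicity, and light tails carry it over to infinite \<open>D\<close>
  (\<open>upper_density_multiples_Int_residue_class_le\<close>). So it suffices to choose \<open>T\<close> with tail density
  below \<open>1 / (K + 2)\<close>: the \<open>K + 2\<close> points of the progression then spoil less than the
  whole class (\<open>infinite_free_exactly_on_progression\<close>).
\<close>

section \<open>Upper density of sets of integers\<close>

lemma upper_density_nonneg: "0 \<le> upper_density A"
  unfolding upper_density_def by (rule le_Limsup) auto

lemma upper_density_mono:
  assumes "\<And>x. x \<in> A \<Longrightarrow> 1 \<le> x \<Longrightarrow> x \<in> A'"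
  shows "upper_density A \<le> upper_density A'"
  unfolding upper_density_def
proof (intro Limsup_mono always_eventually allI)
  fix N :: nat
  have "card (A \<inter> {1..int N}) \<le> card (A' \<inter> {1..int N})"
    using assms by (intro card_mono) auto
  then show "ereal (real (card (A \<inter> {1..int N})) / real N)
      \<le> ereal (real (card (A' \<inter> {1..int N})) / real N)"
    by (simp add: divide_right_mono)
qed

lemma upper_density_Un_le:
  "upper_density (A \<union> A') \<le> upper_density A + upper_density A'"
proof -
  let ?f = "\<lambda>A (N::nat). ereal (real (card (A \<inter> {1..int N})) / real N)"
  have "limsup (?f (A \<union> A')) \<le> limsup (\<lambda>N. ?f A N + ?f A' N)"
  proof (intro Limsup_mono always_eventually allI)
    fix N :: nat
    have "card ((A \<union> A') \<inter> {1..int N}) \<le> card (A \<inter> {1..int N}) + card (A' \<inter> {1..int N})"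
      by (simp add: Int_Un_distrib2 card_Un_le)
    then show "?f (A \<union> A') N \<le> ?f A N + ?f A' N"
      by (simp add: divide_right_mono flip: add_divide_distrib of_nat_add)
  qed
  also have "\<dots> \<le> limsup (?f A) + limsup (?f A')"
    by (rule ereal_limsup_add_mono)
  finally show ?thesis
    unfolding upper_density_def .
qed

lemma upper_density_finite:
  assumes "finite A"
  shows "upper_density A = 0"
proof -
  have "upper_density A \<le> limsup (\<lambda>N::nat. ereal (real (card A) / real N))"
    unfolding upper_density_def
  proof (intro Limsup_mono always_eventually allI)
    fix N :: nat
    have "card (A \<inter> {1..int N}) \<le> card A"
      using assms by (intro card_mono) auto
    then show "ereal (real (card (A \<inter> {1..int N})) / real N) \<le> ereal (real (card A) / real N)"
      by (simp add: divide_right_mono)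
  qed
  also have "\<dots> = 0"
    by (intro lim_imp_Limsup) (auto simp: zero_ereal_def intro: lim_const_over_n)
  finally show ?thesis
    using upper_density_nonneg[of A] by simp
qed

lemma upper_density_UN_le:
  assumes "finite I"
  shows "upper_density (\<Union>i\<in>I. A i) \<le> (\<Sum>i\<in>I. upper_density (A i))"
  using assms
proof (induction I rule: finite_induct)
  case empty
  then show ?case by (simp add: upper_density_finite)
next
  case (insert i I)
  have "upper_density (A i \<union> (\<Union>i\<in>I. A i)) \<le> upper_density (A i) + upper_density (\<Union>i\<in>I. A i)"
    by (rule upper_density_Un_le)
  also have "\<dots> \<le> upper_density (A i) + (\<Sum>i\<in>I. upper_density (A i))"
    by (intro add_left_mono insert.IH)
  finally show ?case
    using insert.hyps by simp
qed

text \<open>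
  Translation changes the count up to \<open>N\<close> by at most \<open>t\<close>, which is negligible against \<open>N\<close>.
\<close>

lemma upper_density_shift_le:
  "upper_density {x. x + int t \<in> A} \<le> upper_density A"
proof -
  let ?f = "\<lambda>N::nat. ereal (real (card (A \<inter> {1..int N})) / real N)"
  have "upper_density {x. x + int t \<in> A} \<le> limsup (\<lambda>N::nat. ?f N + ereal (real t / real N))"
    unfolding upper_density_def
  proof (intro Limsup_mono always_eventually allI)
    fix N :: nat
    have "card ({x. x + int t \<in> A} \<inter> {1..int N})
        = card ((\<lambda>x. x + int t) ` ({x. x + int t \<in> A} \<inter> {1..int N}))"
      by (intro card_image [symmetric]) (auto simp: inj_on_def)
    also have "\<dots> \<le> card (A \<inter> {1..int N} \<union> {int N + 1..int N + int t})"
      by (intro card_mono) auto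
    also have "\<dots> \<le> card (A \<inter> {1..int N}) + card {int N + 1..int N + int t}"
      by (rule card_Un_le)
    finally have "card ({x. x + int t \<in> A} \<inter> {1..int N}) \<le> card (A \<inter> {1..int N}) + t"
      by simp
    then show "ereal (real (card ({x. x + int t \<in> A} \<inter> {1..int N})) / real N)
        \<le> ?f N + ereal (real t / real N)"
      by (simp add: divide_right_mono flip: add_divide_distrib of_nat_add)
  qed
  also have "\<dots> \<le> limsup ?f + limsup (\<lambda>N::nat. ereal (real t / real N))"
    by (rule ereal_limsup_add_mono)
  also have "limsup (\<lambda>N::nat. ereal (real t / real N)) = 0"
    by (intro lim_imp_Limsup) (auto simp: zero_ereal_def intro: lim_const_over_n)
  finally show ?thesis
    by (simp add: upper_density_def)
qed

section \<open>Periodic sets\<close>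

lemma card_periodic_Int:
  fixes A :: "int set"
  assumes periodic: "\<And>x. x + int p \<in> A \<longleftrightarrow> x \<in> A"
  shows "card (A \<inter> {0..<int (n * p)}) = n * card (A \<inter> {0..<int p})"
proof (induction n)
  case 0
  then show ?case by simp
next
  case (Suc n)
  let ?B = "(\<lambda>x. x + int p) ` (A \<inter> {0..<int (n * p)})"
  have "A \<inter> {0..<int (Suc n * p)} = (A \<inter> {0..<int p}) \<union> ?B"
  proof (intro equalityI subsetI)
    fix x assume x: "x \<in> A \<inter> {0..<int (Suc n * p)}"
    show "x \<in> (A \<inter> {0..<int p}) \<union> ?B"
    proof (cases "x < int p")
      case False
      have "x - int p \<in> A"
        using periodic[of "x - int p"] x by simp
      then have "x - int p \<in> A \<inter> {0..<int (n * p)}"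
        using x False by auto
      then show ?thesis
        by (metis UnI2 diff_add_cancel imageI)
    qed (use x in auto)
  next
    fix x assume "x \<in> (A \<inter> {0..<int p}) \<union> ?B"
    then show "x \<in> A \<inter> {0..<int (Suc n * p)}"
      by (auto simp: periodic intro: order_less_le_trans[of _ "int p"])
  qed
  also have "card \<dots> = card (A \<inter> {0..<int p}) + card ?B"
    by (intro card_Un_disjoint) auto
  also have "card ?B = card (A \<inter> {0..<int (n * p)})"
    by (intro card_image) (auto simp: inj_on_def)
  finally show ?case
    using Suc.IH by simp
qed

text \<open>
  The count up to \<open>N\<close> lies between the counts over the \<open>N div p\<close> full periods and over one more
  period, so it stays within bounded distance of \<open>N\<close> times the mean over a period. The extra \<open>1\<close> in
  the bound accounts for the full periods starting at \<open>0\<close> while the density counts from \<open>1\<close>.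
\<close>

lemma upper_density_periodic:
  fixes A :: "int set"
  assumes "p > 0" and periodic: "\<And>x. x + int p \<in> A \<longleftrightarrow> x \<in> A"
  shows "upper_density A = ereal (real (card (A \<inter> {0..<int p})) / real p)"
proof -
  define c where "c = card (A \<inter> {0..<int p})"
  let ?f = "\<lambda>N::nat. real (card (A \<inter> {1..int N})) / real N"
  have bound: "\<bar>real (card (A \<inter> {1..int N})) - real N * (real c / real p)\<bar> \<le> real c + 1" for N
  proof -
    define n where "n = N div p"
    have N: "n * p \<le> N" "N < Suc n * p"
      using \<open>p > 0\<close> dividend_less_div_times[of p N] by (auto simp: n_def algebra_simps)
    have "n * c \<le> card (insert 0 (A \<inter> {1..int N}))"
      unfolding c_def card_periodic_Int[OF periodic, symmetric]
      using N by (intro card_mono) (auto simp del: of_nat_mult)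
    also have "\<dots> \<le> card (A \<inter> {1..int N}) + 1"
      by (simp add: card_insert_if)
    finally have lower: "real n * real c \<le> real (card (A \<inter> {1..int N})) + 1"
      by (simp flip: of_nat_mult of_nat_Suc)
    have "card (A \<inter> {1..int N}) \<le> Suc n * c"
      unfolding c_def card_periodic_Int[OF periodic, symmetric]
      using N by (intro card_mono) (auto simp del: of_nat_mult)
    then have upper: "real (card (A \<inter> {1..int N})) \<le> (real n + 1) * real c"
      by (metis of_nat_Suc of_nat_le_iff of_nat_mult add.commute)
    have "real n \<le> real N / real p" "real N / real p \<le> real n + 1"
      using N \<open>p > 0\<close>
      by (simp_all add: field_simps less_imp_le flip: of_nat_mult of_nat_add)
    then have "real n * real c \<le> real N / real p * real c"
        "real N / real p * real c \<le> (real n + 1) * real c"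
      by (auto intro: mult_right_mono simp del: times_divide_eq_left)
    with lower upper show ?thesis
      by (simp add: algebra_simps abs_le_iff)
  qed
  have "(\<lambda>N. ?f N - real c / real p) \<longlonglongrightarrow> 0"
  proof (rule Lim_null_comparison)
    show "\<forall>\<^sub>F N in sequentially. norm (?f N - real c / real p) \<le> (real c + 1) / real N"
      using eventually_gt_at_top[of 0]
    proof eventually_elim
      case (elim N)
      have "?f N - real c / real p
          = (real (card (A \<inter> {1..int N})) - real N * (real c / real p)) / real N"
        using elim by (simp add: diff_divide_distrib)
      then show ?case
        using bound[of N] elim by (simp add: divide_right_mono)
    qed
    show "(\<lambda>N. (real c + 1) / real N) \<longlonglongrightarrow> 0"
      by (rule lim_const_over_n)
  qed
  then have "?f \<longlonglongrightarrow> real c / real p"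
    by (simp add: LIM_zero_iff)
  then show ?thesis
    unfolding upper_density_def c_def[symmetric]
    by (intro lim_imp_Limsup) auto
qed

lemma upper_density_residue_class:
  assumes "q > 0"
  shows "upper_density {x. [x = a] (mod int q)} = ereal (1 / real q)"
proof -
  have "{x. [x = a] (mod int q)} \<inter> {0..<int q} = {a mod int q}"
    using assms by (auto simp: cong_def)
  then show ?thesis
    using upper_density_periodic[of q "{x. [x = a] (mod int q)}"] assms
    by (simp add: cong_def)
qed

text \<open>
  A set of period \<open>m\<close> is independent of the residue classes modulo a \<open>q\<close> coprime to \<open>m\<close>: by the
  Chinese remainder theorem, each residue modulo \<open>m\<close> has exactly one lift to a residue modulo
  \<open>m * q\<close> in the given class, so the count over a period stays the same while the period
  becomes \<open>q\<close> times as long.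
\<close>

lemma upper_density_periodic_Int_residue_class:
  fixes A :: "int set"
  assumes "m > 0" "q > 0" "coprime m q"
    and periodic: "\<And>x. x + int m \<in> A \<longleftrightarrow> x \<in> A"
  shows "upper_density (A \<inter> {x. [x = a] (mod int q)}) = upper_density A / ereal (real q)"
proof -
  let ?R = "{x. [x = a] (mod int q)}"
  have periodic_mult: "x + int m * k \<in> A \<longleftrightarrow> x \<in> A" for x k
  proof (induction k rule: int_induct[of _ 0])
    case (step1 k)
    then show ?case using periodic[of "x + int m * k"] by (simp add: algebra_simps)
  next
    case (step2 k)
    then show ?case using periodic[of "x + int m * (k - 1)"] by (simp add: algebra_simps)
  qed simp
  have mod_m: "x mod int m \<in> A \<longleftrightarrow> x \<in> A" for x
    using periodic_mult[of x "- (x div int m)"] by (simp add: minus_mult_div_eq_mod)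
  have cop: "coprime (int m) (int q)"
    using assms by simp
  have "bij_betw (\<lambda>x. x mod int m) (A \<inter> ?R \<inter> {0..<int (m * q)}) (A \<inter> {0..<int m})"
    unfolding bij_betw_def
  proof (intro conjI inj_onI equalityI subsetI)
    fix x y assume xy: "x \<in> A \<inter> ?R \<inter> {0..<int (m * q)}" "y \<in> A \<inter> ?R \<inter> {0..<int (m * q)}"
      "x mod int m = y mod int m"
    then have "[x = y] (mod int m)" "[x = y] (mod int q)"
      by (auto simp: cong_def)
    then have "[x = y] (mod int (m * q))"
      using coprime_cong_mult[OF _ _ cop] by simp
    then show "x = y"
      using xy by (auto simp: cong_def simp del: of_nat_mult)
  next
    fix z assume z: "z \<in> A \<inter> {0..<int m}"
    obtain x where x: "[x = z] (mod int m)" "[x = a] (mod int q)"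
      using binary_chinese_remainder_int[OF cop] by blast
    let ?y = "x mod int (m * q)"
    have y: "?y mod int m = z"
      using x(1) z by (simp add: cong_def mod_mult_right_eq mod_mod_cancel)
    have "[?y = a] (mod int q)"
      using x(2) by (simp add: cong_def mod_mod_cancel)
    moreover have "?y \<in> A"
      using mod_m[of ?y] y z by simp
    moreover have "?y \<in> {0..<int (m * q)}"
      using assms by (simp del: of_nat_mult)
    ultimately show "z \<in> (\<lambda>x. x mod int m) ` (A \<inter> ?R \<inter> {0..<int (m * q)})"
      using y by (intro image_eqI[of _ _ ?y]) auto
  qed (use assms mod_m in auto)
  then have card: "card (A \<inter> ?R \<inter> {0..<int (m * q)}) = card (A \<inter> {0..<int m})"
    by (rule bij_betw_same_card)
  have "x + int (m * q) \<in> A \<inter> ?R \<longleftrightarrow> x \<in> A \<inter> ?R" for x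
    using periodic_mult[of x "int q"] by (simp add: cong_def)
  then have "upper_density (A \<inter> ?R) = ereal (real (card (A \<inter> {0..<int m})) / real (m * q))"
    using upper_density_periodic[of "m * q" "A \<inter> ?R"] assms card by simp
  also have "\<dots> = upper_density A / ereal (real q)"
    using upper_density_periodic[of m A] assms by simp
  finally show ?thesis .
qed

section \<open>Sets of multiples with light tails\<close>

text \<open>
  The multiples of the elements up to \<open>T\<close> form a periodic set whose period is coprime to \<open>q\<close>, so the
  independence above applies to them. The other multiples contribute at most the tail density,
  which vanishes as \<open>T\<close> grows although it is not divided by \<open>q\<close>.
\<close>

lemma upper_density_multiples_Int_residue_class_le:
  assumes "0 \<notin> D" "light_tails D" "q > 0" "\<And>b. b \<in> D \<Longrightarrow> coprime b q"
  shows "upper_density (multiples_of_set D \<inter> {x. [x = a] (mod int q)})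
      \<le> upper_density (multiples_of_set D) / ereal (real q)"
proof (rule tendsto_lowerbound)
  let ?tail = "\<lambda>T. upper_density (multiples_of_set {b \<in> D. b > T})"
  let ?u = "upper_density (multiples_of_set D) / ereal (real q)"
  have "(\<lambda>T. ?u + ?tail T) \<longlonglongrightarrow> ?u + 0"
    using assms(2) unfolding light_tails_def
    by (intro tendsto_add_ereal_general tendsto_const) auto
  then show "(\<lambda>T. ?u + ?tail T) \<longlonglongrightarrow> ?u"
    by simp
  show "\<forall>\<^sub>F T in sequentially.
      upper_density (multiples_of_set D \<inter> {x. [x = a] (mod int q)}) \<le> ?u + ?tail T"
  proof (intro always_eventually allI)
    fix T
    let ?D0 = "{b \<in> D. b \<le> T}" and ?D1 = "{b \<in> D. b > T}" and ?R = "{x. [x = a] (mod int q)}"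
    define m where "m = \<Prod>?D0"
    have "m > 0"
      unfolding m_def using assms(1) by (intro prod_pos) (auto intro: Nat.gr0I)
    have "coprime m q"
      unfolding m_def using assms(4) by (intro prod_coprime_left) auto
    have "int b dvd int m" if "b \<in> ?D0" for b
      unfolding m_def of_nat_dvd_iff using that by (intro dvd_prodI) auto
    then have periodic: "x + int m \<in> multiples_of_set ?D0 \<longleftrightarrow> x \<in> multiples_of_set ?D0" for x
      unfolding multiples_of_set_def by (auto simp: dvd_add_left_iff)
    have "upper_density (multiples_of_set D \<inter> ?R)
        \<le> upper_density ((multiples_of_set ?D0 \<inter> ?R) \<union> multiples_of_set ?D1)"
      by (intro upper_density_mono) (auto simp: multiples_of_set_def, meson not_le)
    also have "\<dots> \<le> upper_density (multiples_of_set ?D0 \<inter> ?R) + ?tail T"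
      by (rule upper_density_Un_le)
    also have "upper_density (multiples_of_set ?D0 \<inter> ?R)
        = upper_density (multiples_of_set ?D0) / ereal (real q)"
      using \<open>m > 0\<close> \<open>q > 0\<close> \<open>coprime m q\<close> periodic
      by (rule upper_density_periodic_Int_residue_class)
    also have "\<dots> \<le> ?u"
      using \<open>q > 0\<close>
      by (intro ereal_divide_right_mono upper_density_mono) (auto simp: multiples_of_set_def)
    finally show "upper_density (multiples_of_set D \<inter> ?R) \<le> ?u + ?tail T"
      by (simp add: add_right_mono)
  qed
qed simp

lemma light_tails_subset:
  assumes "light_tails B" "D \<subseteq> B"
  shows "light_tails D"
  unfolding light_tails_def
proof (rule tendsto_sandwich[OF _ _ tendsto_const])
  show "(\<lambda>K. upper_density (multiples_of_set {b \<in> B. b > K})) \<longlonglongrightarrow> 0"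
    using assms(1) by (simp add: light_tails_def)
  show "\<forall>\<^sub>F K in sequentially. upper_density (multiples_of_set {b \<in> D. b > K})
      \<le> upper_density (multiples_of_set {b \<in> B. b > K})"
    using assms(2)
    by (intro always_eventually allI upper_density_mono) (auto simp: multiples_of_set_def)
qed (simp add: upper_density_nonneg)

section \<open>The residue class\<close>

text \<open>
  Elements that share a prime with \<open>n\<close> use distinct primes, since a common one would
  contradict their coprimality, and \<open>n\<close> has only finitely many prime divisors.
\<close>

lemma finite_not_coprime_of_pairwise_coprime:
  fixes C :: "nat set"
  assumes "pairwise coprime C" "n > 0"
  shows "finite {c \<in> C. \<not> coprime c n}"
proof -
  have "\<exists>p. prime p \<and> p dvd c \<and> p dvd n" if "\<not> coprime c n" for c
    using that assms(2) by (metis coprime_iff_gcd_eq_1 prime_factor_nat dvd_trans gcd_dvd1 gcd_dvd2)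
  then obtain p where p: "\<And>c. \<not> coprime c n \<Longrightarrow> prime (p c) \<and> p c dvd c \<and> p c dvd n"
    by metis
  have "inj_on p {c \<in> C. \<not> coprime c n}"
  proof (rule inj_onI, rule ccontr)
    fix c c' assume "c \<in> {c \<in> C. \<not> coprime c n}" "c' \<in> {c \<in> C. \<not> coprime c n}"
      "p c = p c'" "c \<noteq> c'"
    then have "coprime c c'" "p c dvd c" "p c dvd c'" "prime (p c)"
      using assms(1) p by (auto simp: pairwise_def, metis p)
    then show False
      by (meson coprime_common_divisor not_prime_unit)
  qed
  moreover have "p ` {c \<in> C. \<not> coprime c n} \<subseteq> {d. d dvd n}"
    using p by auto
  then have "finite (p ` {c \<in> C. \<not> coprime c n})"
    by (rule finite_subset) (use assms in auto)
  ultimately show ?thesis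
    using finite_imageD by blast
qed

text \<open>
  The modulus is \<open>q = L * (\<Prod>s\<in>I. c s)\<close>, where \<open>I\<close> is the set of positions off the
  progression and the \<open>c s\<close> are distinct elements of \<open>C\<close>. Coprimality of
  \<open>x + i * L\<close> to \<open>L\<close> comes from \<open>x \<equiv> 1\<close> modulo \<open>L\<close>. For \<open>c s\<close>, which divides
  \<open>x + s\<close>, a common divisor would divide the nonzero difference \<open>i * L - s\<close>. That difference divides the
  factorial \<open>F\<close>, to which \<open>c s\<close> is coprime.
\<close>

lemma ex_residue_sieving_all_but_progression:
  fixes C :: "nat set"
  assumes C: "infinite C" "pairwise coprime C" "0 \<notin> C" and "L > 0"
  obtains q :: nat and r :: int where "q > 0" "L dvd q"
    "\<And>x i. [x = r] (mod int q) \<Longrightarrow> i \<le> k \<Longrightarrow> coprime (x + int (i * L)) (int q)"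
    "\<And>x s. [x = r] (mod int q) \<Longrightarrow> s \<le> k * L \<Longrightarrow> \<not> L dvd s \<Longrightarrow> \<exists>c\<in>C. int c dvd x + int s"
proof -
  \<comment> \<open>Large enough to be divisible by \<open>L\<close>, also for \<open>k = 0\<close>, and by every difference of two positions.\<close>
  define F :: nat where "F = fact ((k + 1) * L)"
  define I where "I = {s. s \<le> k * L \<and> \<not> L dvd s}"
  have "finite I"
    by (rule finite_subset[of _ "{..k * L}"]) (auto simp: I_def)
  have "infinite (C - {c \<in> C. \<not> coprime c F})"
    using C finite_not_coprime_of_pairwise_coprime[of C F] by (simp add: F_def)
  then have inf: "infinite {c \<in> C. coprime c F}"
    by (rule contrapos_nn) (auto elim: rev_finite_subset)
  define c where "c = enumerate {c \<in> C. coprime c F}"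
  have c: "c s \<in> C" "coprime (c s) F" for s
    using enumerate_in_set[OF inf, of s] by (auto simp: c_def)
  then have c_pos: "c s > 0" for s
    using C(3) by (metis gr0I)
  have c_cop: "coprime (c s) (c s')" if "s \<noteq> s'" for s s'
    using C(2) c(1)[of s] c(1)[of s'] that inj_enumerate[OF inf]
    by (metis c_def injD pairwiseD)
  define q where "q = L * (\<Prod>s\<in>I. c s)"
  have "L dvd F"
    unfolding F_def using \<open>L > 0\<close> by (intro dvd_fact) auto
  then have "coprime L (\<Prod>s\<in>I. c s)"
    using c(2) by (intro prod_coprime_right) (metis coprime_commute coprime_divisors dvd_refl)
  \<comment> \<open>The residue \<open>(c s - 1) * s\<close> is \<open>- s\<close> modulo \<open>c s\<close>, written without negative numbers.\<close>
  obtain r0 where r0: "\<forall>s\<in>I. [r0 = (c s - 1) * s] (mod c s)"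
    using chinese_remainder_nat[OF \<open>finite I\<close>, of c "\<lambda>s. (c s - 1) * s"] c_cop by blast
  obtain r where r: "[r = 1] (mod L)" "[r = r0] (mod (\<Prod>s\<in>I. c s))"
    using binary_chinese_remainder_nat[OF \<open>coprime L _\<close>] by blast
  have c_dvd: "int (c s) dvd x + int s" if "[x = int r] (mod int q)" "s \<in> I" for x s
  proof -
    have dvd_prod: "c s dvd (\<Prod>s\<in>I. c s)"
      using \<open>finite I\<close> that(2) by (intro dvd_prodI)
    then have "[r = (c s - 1) * s] (mod c s)"
      using r(2) r0 that(2) by (meson cong_dvd_modulus_nat cong_trans)
    then have "[r + s = (c s - 1) * s + s] (mod c s)"
      by (intro cong_add cong_refl)
    also have "(c s - 1) * s + s = c s * s"
      using c_pos[of s] by (simp add: algebra_simps)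
    finally have "c s dvd r + s"
      using cong_dvd_iff by fastforce
    then have "int (c s) dvd int r + int s"
      by (metis of_nat_add of_nat_dvd_iff)
    moreover have "[x + int s = int r + int s] (mod int (c s))"
    proof (rule cong_dvd_modulus)
      show "int (c s) dvd int q"
        using dvd_prod by (simp add: q_def dvd_mult del: of_nat_mult of_nat_prod)
    qed (use that(1) in \<open>intro cong_add cong_refl\<close>)
    ultimately show ?thesis
      using cong_dvd_iff by blast
  qed
  show thesis
  proof (rule that[of q "int r"])
    show "q > 0"
      using \<open>L > 0\<close> c_pos by (auto simp: q_def intro: prod_pos)
    show "L dvd q"
      by (simp add: q_def)
    show "\<exists>c\<in>C. int c dvd x + int s"
      if "[x = int r] (mod int q)" "s \<le> k * L" "\<not> L dvd s" for x s
      using c_dvd[of x s] that c(1)[of s] by (auto simp: I_def)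
    show "coprime (x + int (i * L)) (int q)" if x: "[x = int r] (mod int q)" and "i \<le> k" for x i
    proof -
      have "[x = int r] (mod int L)"
        using x by (rule cong_dvd_modulus) (simp add: q_def)
      also have "[int r = 1] (mod int L)"
        using r(1) by (metis cong_int_iff of_nat_1)
      finally have "[x + int (i * L) = 1 + 0] (mod int L)"
        by (intro cong_add) (simp_all add: cong_0_iff)
      then have "[1 = x + int (i * L)] (mod int L)"
        by (simp add: cong_sym)
      then have "coprime (x + int (i * L)) (int L)"
        by (rule cong_imp_coprime) simp
      moreover have "coprime (x + int (i * L)) (int (c s))" if "s \<in> I" for s
      proof (rule coprimeI)
        fix d :: int assume d: "d dvd x + int (i * L)" "d dvd int (c s)"
        define e where "e = int (i * L) - int s"
        have "d dvd (x + int (i * L)) - (x + int s)"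
          using d c_dvd[OF x that] by (meson dvd_diff dvd_trans)
        then have "d dvd e"
          by (simp add: e_def)
        have "i * L \<le> k * L" "s \<le> k * L"
          using \<open>i \<le> k\<close> \<open>s \<in> I\<close> by (simp_all add: I_def)
        then have "nat \<bar>e\<bar> \<le> k * L"
          unfolding e_def by linarith
        then have "nat \<bar>e\<bar> \<le> (k + 1) * L"
          by simp
        moreover have "s \<noteq> i * L"
          using that by (auto simp: I_def)
        then have "nat \<bar>e\<bar> \<ge> 1"
          by (auto simp: e_def simp del: of_nat_mult)
        ultimately have "nat \<bar>e\<bar> dvd F"
          unfolding F_def by (intro dvd_fact)
        then have "e dvd int F"
          by (metis int_dvd_int_iff nat_abs_dvd_iff)
        then have "d dvd int F"
          using \<open>d dvd e\<close> dvd_trans by blast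
        moreover have "coprime (int (c s)) (int F)"
          using c(2) by simp
        ultimately show "is_unit d"
          using d(2) by (meson coprime_common_divisor)
      qed
      ultimately show ?thesis
        by (auto simp: q_def intro!: prod_coprime_right)
    qed
  qed
qed

section \<open>Progressions of consecutive free numbers\<close>

text \<open>
  With \<open>q\<close> and \<open>r\<close> from the previous lemma, a member \<open>x\<close> of the class fails only if
  some \<open>x + i * L\<close> is a multiple of an element of \<open>D\<close>, the part of \<open>B\<close> coprime to
  \<open>q\<close>. Each of the \<open>k + 1\<close> values of \<open>i\<close> spoils density at most \<open>\<delta> / q\<close>, where
  \<open>\<delta> < 1 / (k + 1)\<close> is the density of the multiples of \<open>D\<close>. The failures therefore have density
  less than \<open>1 / q\<close> and cannot exhaust the class up to a finite set.
\<close>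

lemma infinite_free_exactly_on_progression:
  fixes B :: "nat set"
  assumes "0 \<notin> B" "1 \<notin> B" "light_tails B" "C \<subseteq> B" "infinite C" "pairwise coprime C"
  obtains L where "L \<ge> M" "L > 0"
    "infinite {x. 1 \<le> x \<and> (\<forall>s\<le>k * L. x + int s \<in> free_integers B \<longleftrightarrow> L dvd s)}"
proof -
  have "\<forall>\<^sub>F T in sequentially. upper_density (multiples_of_set {b \<in> B. b > T})
      < ereal (1 / real (k + 1))"
    using assms(3) unfolding light_tails_def by (rule order_tendstoD) auto
  then obtain T where T: "upper_density (multiples_of_set {b \<in> B. b > T}) < ereal (1 / real (k + 1))"
    by (auto simp: eventually_sequentially)
  \<comment> \<open>The product puts every element of \<open>B\<close> up to \<open>T\<close> into \<open>q\<close>; the factor \<open>M + 1\<close> only makes \<open>L\<close> large.\<close>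
  define L where "L = \<Prod>{b \<in> B. b \<le> T} * (M + 1)"
  have prod_pos: "\<Prod>{b \<in> B. b \<le> T} > 0"
    using assms(1) by (intro prod_pos) (auto intro: Nat.gr0I)
  then have "L > 0"
    by (simp add: L_def)
  have "1 * M \<le> L"
    unfolding L_def using prod_pos by (intro mult_le_mono) (simp_all add: Suc_le_eq)
  then have "L \<ge> M"
    by simp
  have "0 \<notin> C"
    using assms(1,4) by blast
  obtain q r where "q > 0" "L dvd q" and
    cop: "\<And>x i. [x = r] (mod int q) \<Longrightarrow> i \<le> k \<Longrightarrow> coprime (x + int (i * L)) (int q)" and
    sieved: "\<And>x s. [x = r] (mod int q) \<Longrightarrow> s \<le> k * L \<Longrightarrow> \<not> L dvd s \<Longrightarrow> \<exists>c\<in>C. int c dvd x + int s"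
    using ex_residue_sieving_all_but_progression[OF assms(5,6) \<open>0 \<notin> C\<close> \<open>L > 0\<close>, of k] by blast
  define D where "D = {b \<in> B. coprime b q}"
  define good where
    "good = {x. 1 \<le> x \<and> (\<forall>s\<le>k * L. x + int s \<in> free_integers B \<longleftrightarrow> L dvd s)}"
  define bad where
    "bad i = multiples_of_set D \<inter> {x. [x = r + int (i * L)] (mod int q)}" for i
  \<comment> \<open>An element up to \<open>T\<close> divides \<open>q\<close> and differs from \<open>1\<close>, so it is not coprime to \<open>q\<close>.\<close>
  have D_large: "b > T" if "b \<in> D" for b
  proof (rule ccontr)
    assume "\<not> b > T"
    then have "b dvd \<Prod>{b \<in> B. b \<le> T}"
      using that by (intro dvd_prodI) (auto simp: D_def)
    then have "b dvd q"
      using \<open>L dvd q\<close> unfolding L_def by (meson dvd_mult2 dvd_trans)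
    then have "b = 1"
      using that coprime_absorb_left[of b q] by (simp add: D_def)
    with that assms(2) show False
      by (auto simp: D_def)
  qed
  have cover: "x \<in> good \<union> (\<Union>i\<in>{..k}. {x. x + int (i * L) \<in> bad i})"
    if x: "x \<in> {x. [x = r] (mod int q)}" "1 \<le> x" for x
  proof (rule UnCI)
    assume not_bad: "x \<notin> (\<Union>i\<in>{..k}. {x. x + int (i * L) \<in> bad i})"
    have "x + int s \<in> free_integers B \<longleftrightarrow> L dvd s" if "s \<le> k * L" for s
    proof
      assume "x + int s \<in> free_integers B"
      then show "L dvd s"
        using sieved[of x s] x that assms(4)
        by (auto simp: free_integers_def multiples_of_set_def)
    next
      assume "L dvd s"
      then obtain i where i: "s = i * L"
        by (metis dvd_def mult.commute)
      then have "i \<le> k"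
        using that \<open>L > 0\<close> by simp
      have "[x + int (i * L) = r + int (i * L)] (mod int q)"
        using x by (intro cong_add cong_refl) auto
      then have not_D: "\<not> int b dvd x + int (i * L)" if "b \<in> D" for b
        using not_bad \<open>i \<le> k\<close> that by (auto simp: bad_def multiples_of_set_def simp del: of_nat_mult)
      have "\<not> int b dvd x + int (i * L)" if "b \<in> B" for b
      proof
        assume "int b dvd x + int (i * L)"
        moreover from this have "coprime (int b) (int q)"
          using cop[of x i] x \<open>i \<le> k\<close> by (meson coprime_divisors dvd_refl mem_Collect_eq)
        ultimately show False
          using not_D[of b] that by (auto simp: D_def)
      qed
      then show "x + int s \<in> free_integers B"
        by (auto simp: free_integers_def multiples_of_set_def i simp del: of_nat_mult)
    qed
    then show "x \<in> good"
      using x by (simp add: good_def)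
  qed
  have "infinite good"
  proof
    assume "finite good"
    have D_less: "upper_density (multiples_of_set D) < ereal (1 / real (k + 1))"
      using D_large
      by (intro le_less_trans[OF upper_density_mono T]) (auto simp: D_def multiples_of_set_def)
    then obtain \<delta> where \<delta>: "upper_density (multiples_of_set D) = ereal \<delta>"
      using upper_density_nonneg[of "multiples_of_set D"]
      by (cases "upper_density (multiples_of_set D)") auto
    have bad: "upper_density {x. x + int (i * L) \<in> bad i} \<le> ereal (\<delta> / real q)" for i
    proof -
      have "upper_density (bad i) \<le> upper_density (multiples_of_set D) / ereal (real q)"
        unfolding bad_def using \<open>q > 0\<close> assms(1)
        by (intro upper_density_multiples_Int_residue_class_le light_tails_subset[OF assms(3)])
           (auto simp: D_def)
      then show ?thesis
        using order_trans[OF upper_density_shift_le[of "i * L" "bad i"]] \<delta> \<open>q > 0\<close>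
        by simp
    qed
    have "ereal (1 / real q) = upper_density {x. [x = r] (mod int q)}"
      using upper_density_residue_class[OF \<open>q > 0\<close>] by simp
    also have "\<dots> \<le> upper_density (good \<union> (\<Union>i\<in>{..k}. {x. x + int (i * L) \<in> bad i}))"
      by (rule upper_density_mono) (rule cover)
    also have "\<dots> \<le> upper_density good + upper_density (\<Union>i\<in>{..k}. {x. x + int (i * L) \<in> bad i})"
      by (rule upper_density_Un_le)
    also have "\<dots> \<le> 0 + (\<Sum>i\<in>{..k}. upper_density {x. x + int (i * L) \<in> bad i})"
      using \<open>finite good\<close> by (intro add_mono upper_density_UN_le) (auto simp: upper_density_finite)
    also have "\<dots> \<le> 0 + (\<Sum>i\<in>{..k}. ereal (\<delta> / real q))"
      by (intro add_left_mono sum_mono bad)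
    finally have "1 / real q \<le> real (k + 1) * (\<delta> / real q)"
      by (simp add: sum_ereal algebra_simps)
    then show False
      using D_less \<delta> \<open>q > 0\<close> by (simp add: field_simps)
  qed
  then show thesis
    using that \<open>L \<ge> M\<close> \<open>L > 0\<close> unfolding good_def by blast
qed

lemma enumerate_eq_progression:
  fixes S :: "nat set"
  assumes "infinite S" "L > 0" "enumerate S j = n"
    and exact: "\<And>s. s \<le> k * L \<Longrightarrow> n + s \<in> S \<longleftrightarrow> L dvd s"
    and "i \<le> k"
  shows "enumerate S (j + i) = n + i * L"
  using \<open>i \<le> k\<close>
proof (induction i)
  case 0
  then show ?case using assms(3) by simp
next
  case (Suc i)
  have "Suc i * L \<le> k * L"
    using Suc.prems by (intro mult_le_mono1)
  have "(LEAST m. m \<in> S \<and> n + i * L < m) = n + Suc i * L"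
  proof (rule Least_equality)
    show "n + Suc i * L \<in> S \<and> n + i * L < n + Suc i * L"
      using exact[OF \<open>Suc i * L \<le> k * L\<close>] \<open>L > 0\<close> by simp
  next
    fix m assume m: "m \<in> S \<and> n + i * L < m"
    show "n + Suc i * L \<le> m"
    proof (rule ccontr)
      assume less: "\<not> n + Suc i * L \<le> m"
      define s where "s = m - n"
      have s: "m = n + s" "i * L < s" "s < Suc i * L"
        using m less by (auto simp: s_def)
      then have "L dvd s"
        using exact[of s] m \<open>Suc i * L \<le> k * L\<close> by auto
      then obtain t where "s = t * L"
        by (metis dvd_def mult.commute)
      with s(2,3) have "i < t" "t < Suc i"
        using mult_less_cancel2 by blast+
      then show False
        by simp
    qed
  qed
  then show ?case
    using Suc enumerate_Suc''[OF assms(1), of "j + i"] by simp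
qed

theorem proposition13:
  fixes B :: "nat set" and K :: nat
  assumes "0 \<notin> B"
    and "primitive_set B"
    and "light_tails B"
    and "\<exists>C\<subseteq>B. infinite C \<and> pairwise coprime C"
    and "K \<ge> 1"
  shows "limsup (\<lambda>j. INF k\<in>{0..K}.
           ereal (real (free_number_seq B (j + k + 1)) - real (free_number_seq B (j + k)))) = \<infinity>"
    (is "limsup ?gap = \<infinity>")
proof (rule ccontr)
  assume "limsup ?gap \<noteq> \<infinity>"
  then obtain M :: nat where "limsup ?gap < ereal (real M)"
    using less_PInf_Ex_of_nat[of "limsup ?gap"] by auto
  then obtain j0 where j0: "\<And>j. j \<ge> j0 \<Longrightarrow> ?gap j < ereal (real M)"
    using Limsup_lessD[of sequentially ?gap "ereal (real M)"]
    unfolding eventually_sequentially by blast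
  obtain C where C: "C \<subseteq> B" "infinite C" "pairwise coprime C"
    using assms(4) by blast
  \<comment> \<open>Since \<open>1\<close> divides everything, a primitive set containing it has no other element.\<close>
  have "1 \<notin> B"
  proof
    assume "1 \<in> B"
    then have "B \<subseteq> {1}"
      using assms(2) by (auto simp: primitive_set_def)
    then show False
      using C(1,2) by (meson finite.emptyI finite_insert finite_subset)
  qed
  let ?S = "natural_free_numbers B"
  obtain L where "L \<ge> M" "L > 0" and
    inf: "infinite {x. 1 \<le> x \<and> (\<forall>s\<le>(K + 1) * L. x + int s \<in> free_integers B \<longleftrightarrow> L dvd s)}"
    (is "infinite ?G")
    using infinite_free_exactly_on_progression[OF assms(1) \<open>1 \<notin> B\<close> assms(3) C] by blast
  have "\<exists>n>m. int n \<in> ?G" for m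
  proof (rule ccontr)
    assume none: "\<not> (\<exists>n>m. int n \<in> ?G)"
    have "?G \<subseteq> {1..int m}"
    proof
      fix x assume x: "x \<in> ?G"
      then have "int (nat x) \<in> ?G"
        by simp
      then have "\<not> nat x > m"
        using none by blast
      then show "x \<in> {1..int m}"
        using x by auto
    qed
    then show False
      using inf finite_subset by blast
  qed
  moreover have start: "n \<in> ?S" if "int n \<in> ?G" for n
    using that by (auto simp: natural_free_numbers_def)
  ultimately have "infinite ?S"
    unfolding infinite_nat_iff_unbounded by blast
  obtain n where n: "n > enumerate ?S j0" "int n \<in> ?G"
    using \<open>\<And>m. \<exists>n>m. int n \<in> ?G\<close> by blast
  obtain j where j: "enumerate ?S j = n"
    using enumerate_Ex[OF \<open>infinite ?S\<close> start[OF n(2)]] by blast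
  then have "j \<ge> j0"
    using n(1) enumerate_mono_iff[OF \<open>infinite ?S\<close>, of j0 j] by linarith
  have "n + s \<in> ?S \<longleftrightarrow> L dvd s" if "s \<le> (K + 1) * L" for s
    using n(2) that by (auto simp: natural_free_numbers_def)
  then have seq: "free_number_seq B (j + i) = n + i * L" if "i \<le> K + 1" for i
    unfolding free_number_seq_def
    using enumerate_eq_progression[OF \<open>infinite ?S\<close> \<open>L > 0\<close> j] that by blast
  have "ereal (real M) \<le> ?gap j"
  proof (rule INF_greatest)
    fix k assume "k \<in> {0..K}"
    then have "free_number_seq B (j + k + 1) = n + (k + 1) * L" "free_number_seq B (j + k) = n + k * L"
      using seq[of "k + 1"] seq[of k] by (auto simp: add.assoc)
    then show "ereal (real M) \<le> ereal (real (free_number_seq B (j + k + 1)) - real (free_number_seq B (j + k)))"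
      using \<open>L \<ge> M\<close> by (simp add: algebra_simps)
  qed
  then show False
    using j0[OF \<open>j \<ge> j0\<close>] by simp
qed

end
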